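(* Let $N \geq 2$ be an integer and let $1 < p \leq \frac{N}{N-1}$. i) If $1 < p < \frac{N}{N-1}$, then there exists a constant $C = C(p, N)$ such that $$|\tilde{I}_N f(x) - \tilde{I}_N f(z)| \leq C|x - z|^{N - \frac{N}{p}} \|f\|_{L^p(\mathbb{R}^N)}$$ for all $f \in L^p(\mathbb{R}^N)$ and all $x, z \in \mathbb{R}^N$. ii) If $p = \frac{N}{N-1}$ and $1 \leq q < p$, then there exists a constant $C = C(q, N)$ such that $$|\tilde{I}_N f(x) - \tilde{I}_N f(z)| \leq C|x - z| \,\bigl(|\ln|x - z|| + 1\bigr)^{\frac{1}{N}} \left(\|f\|_{L^p(\mathbb{R}^N)} + \|f\|_{L^q(\mathbb{R}^N)}\right)$$ for all $f \in L^p(\mathbb{R}^N) \cap L^q(\mathbb{R}^N)$ and all $x, z \in \mathbb{R}^N$.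
   Context: The modified logarithmic potential of a function $f$ is $$\tilde{I}_N f(x) := \frac{\Gamma(\frac{N}{2})}{2\pi^{\frac{N}{2}}} \int_{\mathbb{R}^N} \left[\log \frac{1}{|x - y|} - \log \frac{1}{|y|}\right] f(y) \, dy,$$ where $\log = \ln$ is the natural logarithm. When $x = z$ the right-hand side of the inequality in ii) is understood as $0$. *)

theory Defs
  imports "HOL-Analysis.Analysis"
begin

definition Lp_space :: "real \<Rightarrow> ((real ^ 'n) \<Rightarrow> real) set" where
  "Lp_space p = {f. f \<in> borel_measurable lebesgue \<and> integrable lebesgue (\<lambda>y. \<bar>f y\<bar> powr p)}"

definition Lp_norm :: "real \<Rightarrow> ((real ^ 'n) \<Rightarrow> real) \<Rightarrow> real" where
  "Lp_norm p f = (LINT y|lebesgue. \<bar>f y\<bar> powr p) powr (1 / p)"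

(* The values ln (1 / 0) = 0 at y = x and y = 0 only affect a null set. *)
definition modified_log_potential :: "((real ^ 'n) \<Rightarrow> real) \<Rightarrow> real ^ 'n \<Rightarrow> real" where
  "modified_log_potential f x =
     Gamma (real CARD('n) / 2) / (2 * pi powr (real CARD('n) / 2)) *
     (LINT y|lebesgue. (ln (1 / norm (x - y)) - ln (1 / norm y)) * f y)"

end

(*
With h = |x - z| and s = p' the conjugate exponent, the difference of the two potentials is an
integral of f against ln|z - y| - ln|x - y|. From ln(1 + u) <= u^a / a for 0 < a <= 1 (used with
a = 1 / s and a = 1) this kernel is at most phi(|x - y|) + phi(|z - y|), where phi(r) = s (h / r)^(1/s)
for r < h and phi(r) = h / r for r >= h. Both cases then follow from Hoelder's inequality and radial
integration. For s > N the weight phi is in L^s with norm a multiple of h^(N/s). For s = N it fails to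
be so only logarithmically at infinity: the annulus h <= r < h + 1 produces ln((h + 1) / h)^(1/N), and
on r >= h + 1 the L^q norm of f is used.
*)
theory Submission
  imports Defs
begin

section \<open>Integration of radial functions\<close>

text \<open>The density is the derivative of the ball volume \<open>unit_ball_vol n * r ^ n\<close>
  in the radius, so the fundamental theorem of calculus on \<open>{0..a}\<close> gives the volume of
  a ball of radius \<open>a\<close>. Restricting the density to \<open>{0..}\<close> makes the mass
  vanish for negative \<open>a\<close>.\<close>

lemma emeasure_density_ball_vol:
  fixes a :: real
  defines "n \<equiv> DIM('a::euclidean_space)"
  shows "emeasure (density lborel (\<lambda>r. ennreal (real n * unit_ball_vol (real n) * r ^ (n - 1)) * indicator {0..} r)) {..a}
    = ennreal (if 0 \<le> a then unit_ball_vol (real n) * a ^ n else 0)"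
    (is "emeasure (density lborel (\<lambda>r. ennreal (?g r) * _)) _ = _")
proof -
  have n: "0 < n" by (simp add: n_def)
  have "emeasure (density lborel (\<lambda>r. ennreal (?g r) * indicator {0..} r)) {..a}
    = (\<integral>\<^sup>+r. ennreal (?g r) * indicator {0..} r * indicator {..a} r \<partial>lborel)"
    by (intro emeasure_density) auto
  also have "\<dots> = (\<integral>\<^sup>+r. ennreal (?g r) * indicator {0..a} r \<partial>lborel)"
    by (intro nn_integral_cong) (auto split: split_indicator)
  also have "\<dots> = ennreal (if 0 \<le> a then unit_ball_vol (real n) * a ^ n else 0)"
  proof (cases "0 \<le> a")
    case True
    have "(\<integral>\<^sup>+r. ennreal (?g r) * indicator {0..a} r \<partial>lborel)
        = ennreal (unit_ball_vol (real n) * a ^ n - unit_ball_vol (real n) * 0 ^ n)"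
      using True by (intro nn_integral_FTC_Icc) (auto intro!: derivative_eq_intros)
    with True n show ?thesis by (simp add: zero_power)
  qed simp
  finally show ?thesis .
qed

text \<open>Polar coordinates without a measure on the sphere: on a half line \<open>{..a}\<close>
  both measures give the volume of the ball of radius \<open>a\<close>. The half lines are stable
  under intersection and generate the Borel sets, and those with endpoint \<open>real i\<close> have
  finite mass and exhaust the line, so the measures coincide.\<close>

lemma distr_norm_lborel:
  defines "n \<equiv> DIM('a::euclidean_space)"
  shows "distr (lborel :: 'a measure) borel norm
    = density lborel (\<lambda>r. ennreal (real n * unit_ball_vol (real n) * r ^ (n - 1)) * indicator {0..} r)"
    (is "?M = ?D")
proof (rule measure_eqI_generator_eq[where E = "range atMost" and \<Omega> = UNIV and A = "\<lambda>i. {..real i}"])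
  have M: "emeasure ?M {..a} = ennreal (if 0 \<le> a then unit_ball_vol (real n) * a ^ n else 0)" for a
  proof -
    have "norm -` {..a} = (if 0 \<le> a then cball (0::'a) a else {})"
      using norm_ge_zero by (auto simp: dist_norm dest: order_trans[OF norm_ge_zero])
    then show ?thesis
      by (simp add: emeasure_distr emeasure_cball n_def)
  qed
  show "emeasure ?M X = emeasure ?D X" if "X \<in> range atMost" for X
  proof -
    from that obtain a where "X = {..a}" by auto
    then show ?thesis
      using M[of a] emeasure_density_ball_vol[where 'a='a, of a] by (simp add: n_def)
  qed
  show "emeasure ?M {..real i} \<noteq> \<infinity>" for i
    using M[of "real i"] by simp
  show "Int_stable (range atMost :: real set set)"
    by (auto simp: Int_stable_def)
  show "(\<Union>i. {..real i}) = UNIV"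
    using real_arch_simple by auto
  show "sets ?M = sigma_sets UNIV (range atMost)" "sets ?D = sigma_sets UNIV (range atMost)"
    by (simp_all add: borel_eq_atMost)
qed auto

text \<open>An integral of a function of the norm is an integral against the pushforward of
  \<open>lborel\<close> under \<open>norm\<close>. The factor \<open>n * unit_ball_vol n\<close> is
  the surface area of the unit sphere.\<close>

lemma nn_integral_radial:
  fixes g :: "real \<Rightarrow> ennreal"
  assumes [measurable]: "g \<in> borel_measurable borel"
  defines "n \<equiv> DIM('a::euclidean_space)"
  shows "(\<integral>\<^sup>+y. g (norm (y::'a)) \<partial>lborel) = ennreal (real n * unit_ball_vol (real n)) *
    (\<integral>\<^sup>+r. g r * ennreal (r ^ (n - 1)) * indicator {0..} r \<partial>lborel)"
proof -
  have "(\<integral>\<^sup>+y. g (norm (y::'a)) \<partial>lborel) = (\<integral>\<^sup>+r. g r \<partial>distr (lborel::'a measure) borel norm)"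
    by (simp add: nn_integral_distr)
  also have "\<dots> = (\<integral>\<^sup>+r. ennreal (real n * unit_ball_vol (real n)) *
      (g r * ennreal (r ^ (n - 1)) * indicator {0..} r) \<partial>lborel)"
    unfolding distr_norm_lborel
    by (subst nn_integral_density)
      (auto simp: n_def ennreal_mult algebra_simps split: split_indicator intro!: nn_integral_cong)
  also have "\<dots> = ennreal (real n * unit_ball_vol (real n)) *
    (\<integral>\<^sup>+r. g r * ennreal (r ^ (n - 1)) * indicator {0..} r \<partial>lborel)"
    by (intro nn_integral_cmult) auto
  finally show ?thesis .
qed

section \<open>Hoelder's inequality for nonnegative integrals\<close>

text \<open>Only upper bounds \<open>A\<close> and \<open>B\<close> of the two integrals enter, and
  the product need not be known to be integrable; finiteness of its integral is part of the result.
  The proof integrates Young's inequality for the normalized functions \<open>u / a\<close> and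
  \<open>v / b\<close>.\<close>

lemma nn_integral_Holder:
  fixes u v :: "'a \<Rightarrow> real" and p q A B :: real
  assumes [measurable]: "u \<in> borel_measurable M" "v \<in> borel_measurable M"
    and pq: "1 < p" "1 < q" "1 / p + 1 / q = 1"
    and AB: "0 \<le> A" "0 \<le> B"
    and A: "(\<integral>\<^sup>+x. ennreal (\<bar>u x\<bar> powr p) \<partial>M) \<le> ennreal A"
    and B: "(\<integral>\<^sup>+x. ennreal (\<bar>v x\<bar> powr q) \<partial>M) \<le> ennreal B"
  shows "(\<integral>\<^sup>+x. ennreal (\<bar>u x * v x\<bar>) \<partial>M) \<le> ennreal (A powr (1 / p) * B powr (1 / q))"
proof (cases "A = 0 \<or> B = 0")
  case True
  \<comment> \<open>Normalizing would divide by zero here. Instead, a vanishing bound forces one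
    factor, hence the product, to vanish almost everywhere.\<close>
  have zero: "AE x in M. w x = 0"
    if "w \<in> borel_measurable M" "(\<integral>\<^sup>+x. ennreal (\<bar>w x\<bar> powr s) \<partial>M) \<le> ennreal 0" for w :: "'a \<Rightarrow> real" and s
  proof -
    have [measurable]: "w \<in> borel_measurable M" by fact
    have "(\<integral>\<^sup>+x. ennreal (\<bar>w x\<bar> powr s) \<partial>M) = 0"
      using that(2) by simp
    then have "AE x in M. ennreal (\<bar>w x\<bar> powr s) = 0"
      by (subst (asm) nn_integral_0_iff_AE) auto
    then show ?thesis
      by eventually_elim (metis abs_eq_0 ennreal_eq_0_iff powr_ge_zero powr_eq_0_iff antisym)
  qed
  have "AE x in M. u x * v x = 0"
    using True
  proof
    assume "A = 0"
    with A zero[of u p] have "AE x in M. u x = 0" by simp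
    then show ?thesis by eventually_elim simp
  next
    assume "B = 0"
    with B zero[of v q] have "AE x in M. v x = 0" by simp
    then show ?thesis by eventually_elim simp
  qed
  then have "(\<integral>\<^sup>+x. ennreal (\<bar>u x * v x\<bar>) \<partial>M) = (\<integral>\<^sup>+x. 0 \<partial>M)"
    by (intro nn_integral_cong_AE) (auto elim!: eventually_mono)
  then show ?thesis by simp
next
  case False
  with AB have pos: "0 < A" "0 < B" by auto
  \<comment> \<open>\<open>a\<close> and \<open>b\<close> bound the norms of \<open>u\<close> and
    \<open>v\<close>. After division by them both integrals in Young's inequality are at most 1, and
    \<open>1 / p + 1 / q = 1\<close> adds up the two terms.\<close>
  define a where "a = A powr (1 / p)"
  define b where "b = B powr (1 / q)"
  have ab: "0 < a" "0 < b" "a powr p = A" "b powr q = B"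
    using pos pq by (auto simp: a_def b_def powr_powr)
  have pt: "\<bar>u x * v x\<bar> \<le> a * b / (p * A) * \<bar>u x\<bar> powr p + a * b / (q * B) * \<bar>v x\<bar> powr q" for x
  proof -
    have "(\<bar>u x\<bar> / a) * (\<bar>v x\<bar> / b) \<le> (\<bar>u x\<bar> / a) powr p / p + (\<bar>v x\<bar> / b) powr q / q"
      using ab pq by (intro Youngs_inequality) auto
    also have "\<dots> = \<bar>u x\<bar> powr p / (p * A) + \<bar>v x\<bar> powr q / (q * B)"
      using ab by (simp add: powr_divide mult.commute)
    finally have "a * b * ((\<bar>u x\<bar> / a) * (\<bar>v x\<bar> / b)) \<le> a * b * (\<bar>u x\<bar> powr p / (p * A) + \<bar>v x\<bar> powr q / (q * B))"
      using ab by (intro mult_left_mono) auto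
    then show ?thesis
      using ab by (simp add: abs_mult algebra_simps)
  qed
  have "(\<integral>\<^sup>+x. ennreal (\<bar>u x * v x\<bar>) \<partial>M)
      \<le> (\<integral>\<^sup>+x. ennreal (a * b / (p * A)) * ennreal (\<bar>u x\<bar> powr p) + ennreal (a * b / (q * B)) * ennreal (\<bar>v x\<bar> powr q) \<partial>M)"
    using pt ab pq pos by (intro nn_integral_mono) (auto simp flip: ennreal_mult ennreal_plus intro!: ennreal_leI)
  also have "\<dots> = ennreal (a * b / (p * A)) * (\<integral>\<^sup>+x. ennreal (\<bar>u x\<bar> powr p) \<partial>M)
      + ennreal (a * b / (q * B)) * (\<integral>\<^sup>+x. ennreal (\<bar>v x\<bar> powr q) \<partial>M)"
    by (simp add: nn_integral_add nn_integral_cmult)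
  also have "\<dots> \<le> ennreal (a * b / (p * A)) * ennreal A + ennreal (a * b / (q * B)) * ennreal B"
    by (intro add_mono mult_left_mono A B) auto
  also have "\<dots> = ennreal (a * b / p + a * b / q)"
    using ab pq pos by (simp flip: ennreal_mult ennreal_plus add: algebra_simps)
  also have "a * b / p + a * b / q = a * b * (1 / p + 1 / q)"
    by (simp add: algebra_simps)
  finally show ?thesis
    using pq by (simp add: a_def b_def)
qed

section \<open>Elementary inequalities for powers and logarithms\<close>

text \<open>The numbers \<open>1 / (1 + u)\<close> and \<open>u / (1 + u)\<close> lie in the unit
  interval and add up to 1. Raising them to a power \<alpha> \<le> 1 can only increase them, so
  their powers add up to at least 1.\<close>

lemma one_plus_powr_le:
  fixes u \<alpha> :: real
  assumes "0 \<le> u" "0 < \<alpha>" "\<alpha> \<le> 1"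
  shows "(1 + u) powr \<alpha> \<le> 1 + u powr \<alpha>"
proof -
  have le: "t \<le> t powr \<alpha>" if "0 \<le> t" "t \<le> 1" for t :: real
    using powr_mono'[of \<alpha> 1 t] that assms by simp
  have "1 = 1 / (1 + u) + u / (1 + u)"
    using assms by (simp flip: add_divide_distrib)
  also have "\<dots> \<le> (1 / (1 + u)) powr \<alpha> + (u / (1 + u)) powr \<alpha>"
    using assms by (intro add_mono le) auto
  also have "\<dots> = (1 + u powr \<alpha>) / (1 + u) powr \<alpha>"
    using assms by (simp add: powr_divide add_divide_distrib)
  finally show ?thesis
    using assms by (simp add: field_simps)
qed

text \<open>For x \<le> y, apply \<open>ln t \<le> t - 1\<close> to
  \<open>t = (y / x) powr \<alpha>\<close> and then subadditivity of the power to
  \<open>y / x = 1 + (y - x) / x\<close>. The free exponent trades the strength of the singularity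
  at small \<open>min s t\<close> against decay at large \<open>min s t\<close>.\<close>

lemma abs_ln_diff_le:
  fixes s t \<alpha> :: real
  assumes "0 < s" "0 < t" "0 < \<alpha>" "\<alpha> \<le> 1"
  shows "\<bar>ln s - ln t\<bar> \<le> 1 / \<alpha> * (\<bar>s - t\<bar> / min s t) powr \<alpha>"
proof -
  have *: "ln y - ln x \<le> 1 / \<alpha> * ((y - x) / x) powr \<alpha>" if "0 < x" "x \<le> y" for x y
  proof -
    have "(y / x) powr \<alpha> = (1 + (y - x) / x) powr \<alpha>"
      using that by (simp add: field_simps)
    also have "\<dots> \<le> 1 + ((y - x) / x) powr \<alpha>"
      using that assms by (intro one_plus_powr_le) auto
    finally have 1: "(y / x) powr \<alpha> - 1 \<le> ((y - x) / x) powr \<alpha>"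
      by simp
    have "\<alpha> * (ln y - ln x) = ln ((y / x) powr \<alpha>)"
      using that by (simp add: ln_powr ln_div)
    also have "\<dots> \<le> (y / x) powr \<alpha> - 1"
      using that by (intro ln_le_minus_one) auto
    finally show ?thesis
      using 1 assms by (simp add: field_simps)
  qed
  show ?thesis
    using *[of s t] *[of t s] assms by (cases "s \<le> t") (auto simp: abs_minus_commute)
qed

section \<open>Norms of the radial weights and the resulting integral bounds\<close>

lemma nn_integral_norm_translate:
  fixes g :: "real \<Rightarrow> ennreal" and c :: "'a::euclidean_space"
  assumes [measurable]: "g \<in> borel_measurable borel"
  shows "(\<integral>\<^sup>+y. g (norm (c - y)) \<partial>lebesgue) = (\<integral>\<^sup>+y. g (norm (y::'a)) \<partial>lborel)"
proof -
  \<comment> \<open>Completion does not change the integral of a Borel function, and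
    \<open>lborel\<close> is invariant under translation. Substituting \<open>c + y\<close> for
    \<open>y\<close> turns \<open>c - y\<close> into \<open>- y\<close>, which has the same norm as
    \<open>y\<close>.\<close>
  have "(\<integral>\<^sup>+y. g (norm (c - y)) \<partial>lebesgue) = (\<integral>\<^sup>+y. g (norm (c - y)) \<partial>distr lborel borel ((+) c))"
    by (simp add: nn_integral_completion lborel_distr_plus)
  also have "\<dots> = (\<integral>\<^sup>+y. g (norm (y::'a)) \<partial>lborel)"
    by (subst nn_integral_distr) auto
  finally show ?thesis .
qed

text \<open>Reduces each weight estimate to one radial integral over \<open>lborel\<close>. By
  translation invariance the bound is the same for every centre \<open>c\<close>.\<close>

lemma nn_integral_radial_Holder:
  fixes f :: "real ^ 'n \<Rightarrow> real" and w :: "real \<Rightarrow> real"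
  assumes f: "f \<in> Lp_space p" and [measurable]: "w \<in> borel_measurable borel"
    and sp: "1 < s" "1 < p" "1 / s + 1 / p = 1" and "0 \<le> A"
    and A: "(\<integral>\<^sup>+y. ennreal (\<bar>w (norm (y :: real ^ 'n))\<bar> powr s) \<partial>lborel) \<le> ennreal A"
  shows "(\<integral>\<^sup>+y. ennreal \<bar>w (norm (c - y)) * f y\<bar> \<partial>lebesgue) \<le> ennreal (A powr (1 / s) * Lp_norm p f)"
  unfolding Lp_norm_def
proof (rule nn_integral_Holder)
  show "(\<lambda>y. w (norm (c - y))) \<in> borel_measurable lebesgue"
    by (rule measurable_completion) simp
  show "f \<in> borel_measurable lebesgue"
    using f by (simp add: Lp_space_def)
  have "(\<integral>\<^sup>+y. ennreal (\<bar>w (norm (c - y))\<bar> powr s) \<partial>lebesgue)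
      = (\<integral>\<^sup>+y. ennreal (\<bar>w (norm (y :: real ^ 'n))\<bar> powr s) \<partial>lborel)"
    by (rule nn_integral_norm_translate[where g = "\<lambda>r. ennreal (\<bar>w r\<bar> powr s)"]) simp
  then show "(\<integral>\<^sup>+y. ennreal (\<bar>w (norm (c - y))\<bar> powr s) \<partial>lebesgue) \<le> ennreal A"
    using A by simp
  show "(\<integral>\<^sup>+y. ennreal (\<bar>f y\<bar> powr p) \<partial>lebesgue) \<le> ennreal (LINT y|lebesgue. \<bar>f y\<bar> powr p)"
    using f by (subst nn_integral_eq_integral) (auto simp: Lp_space_def)
qed (use sp \<open>0 \<le> A\<close> in auto)

lemma Lp_norm_nonneg: "0 \<le> Lp_norm p f"
  by (simp add: Lp_norm_def)

text \<open>The exponent \<open>1 / s\<close> is chosen so that the \<open>s\<close>-th power of the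
  weight is a multiple of \<open>h / r\<close>, which is integrable at the origin in dimension at
  least 2. Its integral over the ball of radius \<open>h\<close> scales like \<open>h ^ n\<close>,
  and the \<open>s\<close>-th root gives \<open>h powr (n / s)\<close>. The constant is obtained
  before \<open>f\<close>, \<open>c\<close> and \<open>h\<close>, hence is uniform in them.\<close>

lemma near_weight_bound:
  assumes N: "2 \<le> CARD('n::finite)" and sp: "1 < s" "1 < p" "1 / s + 1 / p = 1"
  obtains K where "0 \<le> K"
    "\<And>(f :: real ^ 'n \<Rightarrow> real) c h. f \<in> Lp_space p \<Longrightarrow> 0 < h \<Longrightarrow>
       (\<integral>\<^sup>+y. ennreal \<bar>(if norm (c - y) < h then s * (h / norm (c - y)) powr (1 / s) else 0) * f y\<bar> \<partial>lebesgue)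
         \<le> ennreal (K * h powr (real CARD('n) / s) * Lp_norm p f)"
proof
  let ?n = "CARD('n)"
  define V where "V = real ?n * unit_ball_vol (real ?n)"
  \<comment> \<open>The integral of the \<open>s\<close>-th power of the weight for
    \<open>h = 1\<close>: sphere area times the integral of \<open>s powr s * r ^ (n - 2)\<close>
    over the unit interval.\<close>
  define A where "A = V * (s powr s / (real ?n - 1))"
  have V: "0 \<le> V" and A: "0 \<le> A"
    using N by (simp_all add: V_def A_def)
  \<comment> \<open>This obligation fixes the witness for \<open>K\<close>.\<close>
  show "0 \<le> A powr (1 / s)" by simp
  fix f :: "real ^ 'n \<Rightarrow> real" and c and h :: real
  assume f: "f \<in> Lp_space p" and h: "0 < h"
  define w where "w r = (if r < h then s * (h / r) powr (1 / s) else 0)" for r :: real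
  have [measurable]: "w \<in> borel_measurable borel"
    unfolding w_def by measurable
  have "(\<integral>\<^sup>+y. ennreal (\<bar>w (norm (y :: real ^ 'n))\<bar> powr s) \<partial>lborel)
      = ennreal V * (\<integral>\<^sup>+r. ennreal (\<bar>w r\<bar> powr s) * ennreal (r ^ (?n - 1)) * indicator {0..} r \<partial>lborel)"
    unfolding V_def using nn_integral_radial[of "\<lambda>r. ennreal (\<bar>w r\<bar> powr s)", where 'a = "real ^ 'n"] by simp
  also have "(\<integral>\<^sup>+r. ennreal (\<bar>w r\<bar> powr s) * ennreal (r ^ (?n - 1)) * indicator {0..} r \<partial>lborel)
      \<le> (\<integral>\<^sup>+r. ennreal (s powr s * h * r ^ (?n - 2)) * indicator {0..h} r \<partial>lborel)"
  proof (rule nn_integral_mono)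
    fix r :: real
    have "\<bar>w r\<bar> powr s * r ^ (?n - 1) = s powr s * h * r ^ (?n - 2)" if "0 < r" "r < h"
    proof -
      have "\<bar>w r\<bar> powr s = s powr s * (h / r)"
        using that sp by (simp add: w_def abs_mult powr_mult powr_powr)
      moreover have "r ^ (?n - 1) = r * r ^ (?n - 2)"
        using N by (simp flip: power_Suc add: numeral_2_eq_2 Suc_diff_Suc)
      ultimately show ?thesis using that by simp
    qed
    \<comment> \<open>The identity above cancels \<open>r\<close> and needs r > 0; at the origin
      \<open>h / 0 = 0\<close> makes the weight vanish.\<close>
    moreover have "w 0 = 0" by (simp add: w_def)
    ultimately show "ennreal (\<bar>w r\<bar> powr s) * ennreal (r ^ (?n - 1)) * indicator {0..} r
        \<le> ennreal (s powr s * h * r ^ (?n - 2)) * indicator {0..h} r"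
      using h by (cases "r = 0"; cases "r < h")
        (auto split: split_indicator simp: w_def simp flip: ennreal_mult)
  qed
  also have "\<dots> = ennreal (s powr s * h * h ^ (?n - 1) / (real ?n - 1) - s powr s * h * 0 ^ (?n - 1) / (real ?n - 1))"
  proof (rule nn_integral_FTC_Icc)
    have "real (?n - Suc 0) = real ?n - 1" "?n - Suc (Suc 0) = ?n - 2" "real ?n - 1 \<noteq> 0"
      using N by (auto simp: of_nat_diff)
    then show "((\<lambda>r. s powr s * h * r ^ (?n - 1) / (real ?n - 1)) has_real_derivative s powr s * h * x ^ (?n - 2)) (at x)" for x
      by (auto intro!: derivative_eq_intros)
  qed (use h in auto)
  also have "\<dots> = ennreal (s powr s / (real ?n - 1) * h ^ ?n)"
    using N power_minus_mult[of ?n h, symmetric] by (simp add: zero_power mult_ac)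
  also have "ennreal V * \<dots> = ennreal (A * h ^ ?n)"
    using V N h by (simp add: A_def flip: ennreal_mult)
  finally have "(\<integral>\<^sup>+y. ennreal (\<bar>w (norm (y :: real ^ 'n))\<bar> powr s) \<partial>lborel) \<le> ennreal (A * h ^ ?n)"
    by (simp add: mult_left_mono)
  from nn_integral_radial_Holder[OF f _ sp _ this, of c]
  have "(\<integral>\<^sup>+y. ennreal \<bar>w (norm (c - y)) * f y\<bar> \<partial>lebesgue)
      \<le> ennreal ((A * h ^ ?n) powr (1 / s) * Lp_norm p f)"
    using A h by simp
  also have "(A * h ^ ?n) powr (1 / s) = A powr (1 / s) * h powr (real ?n / s)"
    using A h by (simp add: powr_mult powr_powr flip: powr_realpow)
  finally show "(\<integral>\<^sup>+y. ennreal \<bar>(if norm (c - y) < h then s * (h / norm (c - y)) powr (1 / s) else 0) * f y\<bar> \<partial>lebesgue)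
         \<le> ennreal (A powr (1 / s) * h powr (real CARD('n) / s) * Lp_norm p f)"
    by (simp add: w_def)
qed

text \<open>At the critical exponent \<open>s = n\<close> the \<open>n\<close>-th power of
  \<open>h / r\<close> times the radial density \<open>r ^ (n - 1)\<close> is
  \<open>h ^ n / r\<close>. Its antiderivative is a logarithm, and the \<open>n\<close>-th root
  produces the power \<open>1 / n\<close> of \<open>ln (R / h)\<close>.\<close>

lemma annulus_weight_bound:
  assumes sp: "1 < p" "1 / real CARD('n) + 1 / p = 1" and N: "2 \<le> CARD('n::finite)"
  obtains K where "0 \<le> K"
    "\<And>(f :: real ^ 'n \<Rightarrow> real) c h R. f \<in> Lp_space p \<Longrightarrow> 0 < h \<Longrightarrow> h \<le> R \<Longrightarrow>
       (\<integral>\<^sup>+y. ennreal \<bar>(if h \<le> norm (c - y) \<and> norm (c - y) < R then h / norm (c - y) else 0) * f y\<bar> \<partial>lebesgue)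
         \<le> ennreal (K * h * ln (R / h) powr (1 / real CARD('n)) * Lp_norm p f)"
proof
  let ?n = "CARD('n)"
  define V where "V = real ?n * unit_ball_vol (real ?n)"
  have V: "0 \<le> V"
    by (simp add: V_def)
  show "0 \<le> V powr (1 / real ?n)" by simp
  fix f :: "real ^ 'n \<Rightarrow> real" and c and h R :: real
  assume f: "f \<in> Lp_space p" and h: "0 < h" and R: "h \<le> R"
  define w where "w r = (if h \<le> r \<and> r < R then h / r else 0)" for r :: real
  have [measurable]: "w \<in> borel_measurable borel"
    unfolding w_def by measurable
  have ln: "0 \<le> ln (R / h)" using h R by simp
  have "(\<integral>\<^sup>+y. ennreal (\<bar>w (norm (y :: real ^ 'n))\<bar> powr real ?n) \<partial>lborel)
      = ennreal V * (\<integral>\<^sup>+r. ennreal (\<bar>w r\<bar> powr real ?n) * ennreal (r ^ (?n - 1)) * indicator {0..} r \<partial>lborel)"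
    unfolding V_def using nn_integral_radial[of "\<lambda>r. ennreal (\<bar>w r\<bar> powr real ?n)", where 'a = "real ^ 'n"] by simp
  also have "(\<integral>\<^sup>+r. ennreal (\<bar>w r\<bar> powr real ?n) * ennreal (r ^ (?n - 1)) * indicator {0..} r \<partial>lborel)
      \<le> (\<integral>\<^sup>+r. ennreal (h ^ ?n / r) * indicator {h..R} r \<partial>lborel)"
  proof (rule nn_integral_mono)
    fix r :: real
    have "\<bar>w r\<bar> powr real ?n * r ^ (?n - 1) = h ^ ?n / r" if "h \<le> r" "r < R"
    proof -
      have "r ^ ?n = r * r ^ (?n - 1)"
        using power_minus_mult[of ?n r] by (simp add: mult.commute)
      then show ?thesis
        using that h by (simp add: w_def powr_realpow power_divide)
    qed
    then show "ennreal (\<bar>w r\<bar> powr real ?n) * ennreal (r ^ (?n - 1)) * indicator {0..} r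
        \<le> ennreal (h ^ ?n / r) * indicator {h..R} r"
      using h by (cases "h \<le> r \<and> r < R")
        (auto split: split_indicator simp: w_def simp flip: ennreal_mult)
  qed
  also have "\<dots> = ennreal (h ^ ?n * ln R - h ^ ?n * ln h)"
    using h R by (intro nn_integral_FTC_Icc) (auto intro!: derivative_eq_intros)
  also have "h ^ ?n * ln R - h ^ ?n * ln h = h ^ ?n * ln (R / h)"
    using h R by (simp add: ln_div algebra_simps)
  also have "ennreal V * ennreal (h ^ ?n * ln (R / h)) = ennreal (V * h ^ ?n * ln (R / h))"
    using V h ln by (simp add: mult.assoc flip: ennreal_mult)
  finally have "(\<integral>\<^sup>+y. ennreal (\<bar>w (norm (y :: real ^ 'n))\<bar> powr real ?n) \<partial>lborel)
      \<le> ennreal (V * h ^ ?n * ln (R / h))"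
    by (simp add: mult_left_mono)
  from nn_integral_radial_Holder[OF f _ _ sp _ this, of c]
  have "(\<integral>\<^sup>+y. ennreal \<bar>w (norm (c - y)) * f y\<bar> \<partial>lebesgue)
      \<le> ennreal ((V * h ^ ?n * ln (R / h)) powr (1 / real ?n) * Lp_norm p f)"
    using V h ln N by simp
  also have "(V * h ^ ?n * ln (R / h)) powr (1 / real ?n) = V powr (1 / real ?n) * h * ln (R / h) powr (1 / real ?n)"
    using V h ln by (simp add: powr_mult powr_powr flip: powr_realpow)
  finally show "(\<integral>\<^sup>+y. ennreal \<bar>(if h \<le> norm (c - y) \<and> norm (c - y) < R then h / norm (c - y) else 0) * f y\<bar> \<partial>lebesgue)
         \<le> ennreal (V powr (1 / real ?n) * h * ln (R / h) powr (1 / real ?n) * Lp_norm p f)"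
    by (simp add: w_def)
qed

text \<open>Since s > n, the radial integrand \<open>r powr (n - s - 1)\<close> is integrable at
  infinity, and its tail from \<open>R\<close> is \<open>R powr (n - s) / (s - n)\<close>. Taking
  the \<open>s\<close>-th root gives \<open>h * R powr (n / s - 1)\<close> up to a constant.\<close>

lemma far_weight_bound:
  assumes sp: "1 < p" "1 / s + 1 / p = 1" and N: "2 \<le> CARD('n::finite)" "real CARD('n) < s"
  obtains K where "0 \<le> K"
    "\<And>(f :: real ^ 'n \<Rightarrow> real) c h R. f \<in> Lp_space p \<Longrightarrow> 0 < h \<Longrightarrow> 0 < R \<Longrightarrow>
       (\<integral>\<^sup>+y. ennreal \<bar>(if R \<le> norm (c - y) then h / norm (c - y) else 0) * f y\<bar> \<partial>lebesgue)
         \<le> ennreal (K * h * R powr (real CARD('n) / s - 1) * Lp_norm p f)"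
proof
  let ?n = "CARD('n)"
  define V where "V = real ?n * unit_ball_vol (real ?n)"
  define A where "A = V / (s - real ?n)"
  have V: "0 \<le> V" and A: "0 \<le> A"
    using N by (simp_all add: V_def A_def)
  have s: "1 < s" using N by simp
  show "0 \<le> A powr (1 / s)" by simp
  fix f :: "real ^ 'n \<Rightarrow> real" and c and h R :: real
  assume f: "f \<in> Lp_space p" and h: "0 < h" and R: "0 < R"
  define w where "w r = (if R \<le> r then h / r else 0)" for r :: real
  have [measurable]: "w \<in> borel_measurable borel"
    unfolding w_def by measurable
  have "(\<integral>\<^sup>+y. ennreal (\<bar>w (norm (y :: real ^ 'n))\<bar> powr s) \<partial>lborel)
      = ennreal V * (\<integral>\<^sup>+r. ennreal (\<bar>w r\<bar> powr s) * ennreal (r ^ (?n - 1)) * indicator {0..} r \<partial>lborel)"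
    unfolding V_def using nn_integral_radial[of "\<lambda>r. ennreal (\<bar>w r\<bar> powr s)", where 'a = "real ^ 'n"] by simp
  also have "(\<integral>\<^sup>+r. ennreal (\<bar>w r\<bar> powr s) * ennreal (r ^ (?n - 1)) * indicator {0..} r \<partial>lborel)
      = (\<integral>\<^sup>+r. ennreal (h powr s * r powr (real ?n - s - 1)) * indicator {R..} r \<partial>lborel)"
  proof (rule nn_integral_cong)
    fix r :: real
    have "\<bar>w r\<bar> powr s * r ^ (?n - 1) = h powr s * r powr (real ?n - s - 1)" if "R \<le> r"
    proof -
      have "r ^ (?n - 1) = r powr (real ?n - 1)"
        using R that by (simp flip: powr_realpow)
      then have "\<bar>w r\<bar> powr s * r ^ (?n - 1) = h powr s * (r powr (real ?n - 1) / r powr s)"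
        using that h R by (simp add: w_def powr_divide)
      also have "r powr (real ?n - 1) / r powr s = r powr (real ?n - s - 1)"
        by (simp add: algebra_simps flip: powr_diff)
      finally show ?thesis .
    qed
    then show "ennreal (\<bar>w r\<bar> powr s) * ennreal (r ^ (?n - 1)) * indicator {0..} r
        = ennreal (h powr s * r powr (real ?n - s - 1)) * indicator {R..} r"
      using R by (cases "R \<le> r")
        (auto split: split_indicator simp: w_def simp flip: ennreal_mult)
  qed
  \<comment> \<open>The antiderivative carries the negative power \<open>n - s\<close>, so it tends
    to 0 at infinity and only the endpoint \<open>R\<close> contributes.\<close>
  also have "\<dots> = ennreal (0 - - (h powr s / (s - real ?n)) * R powr (real ?n - s))"
  proof (rule nn_integral_FTC_atLeast)
    show "((\<lambda>r. - (h powr s / (s - real ?n)) * r powr (real ?n - s)) has_real_derivative h powr s * x powr (real ?n - s - 1)) (at x)"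
      if "R \<le> x" for x
      using that R N by (auto intro!: derivative_eq_intros simp: divide_simps) (simp add: algebra_simps)
    have "((\<lambda>r. - (h powr s / (s - real ?n)) * r powr (real ?n - s)) \<longlongrightarrow> - (h powr s / (s - real ?n)) * 0) at_top"
      using N by (intro tendsto_mult tendsto_const tendsto_neg_powr filterlim_ident) auto
    then show "((\<lambda>r. - (h powr s / (s - real ?n)) * r powr (real ?n - s)) \<longlongrightarrow> 0) at_top"
      by simp
  qed auto
  also have "ennreal V * \<dots> = ennreal (A * h powr s * R powr (real ?n - s))"
    using V N h by (simp add: A_def flip: ennreal_mult)
  finally have "(\<integral>\<^sup>+y. ennreal (\<bar>w (norm (y :: real ^ 'n))\<bar> powr s) \<partial>lborel)
      \<le> ennreal (A * h powr s * R powr (real ?n - s))"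
    by simp
  from nn_integral_radial_Holder[OF f _ s sp _ this, of c]
  have "(\<integral>\<^sup>+y. ennreal \<bar>w (norm (c - y)) * f y\<bar> \<partial>lebesgue)
      \<le> ennreal ((A * h powr s * R powr (real ?n - s)) powr (1 / s) * Lp_norm p f)"
    using A h by simp
  also have "(A * h powr s * R powr (real ?n - s)) powr (1 / s) = A powr (1 / s) * h * R powr (real ?n / s - 1)"
    using A h s by (simp add: powr_mult powr_powr diff_divide_distrib)
  finally show "(\<integral>\<^sup>+y. ennreal \<bar>(if R \<le> norm (c - y) then h / norm (c - y) else 0) * f y\<bar> \<partial>lebesgue)
         \<le> ennreal (A powr (1 / s) * h * R powr (real ?n / s - 1) * Lp_norm p f)"
    by (simp add: w_def)
qed

section \<open>From the logarithmic kernel to differences of potentials\<close>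

text \<open>The distances of \<open>y\<close> to \<open>a\<close> and \<open>b\<close> differ by at
  most \<open>h\<close>, so the kernel is controlled by \<open>h / m\<close> with \<open>m\<close>
  the smaller distance. Replacing \<phi>(m) by the sum of both values costs nothing essential and
  removes the minimum, leaving two weights with fixed centres.\<close>

lemma log_kernel_le:
  fixes a b y :: "'a::real_normed_vector" and s :: real
  assumes s: "1 \<le> s" and y: "y \<noteq> a" "y \<noteq> b"
  defines "h \<equiv> norm (a - b)"
  defines "\<phi> \<equiv> \<lambda>r. if r < h then s * (h / r) powr (1 / s) else h / r"
  shows "\<bar>ln (norm (a - y)) - ln (norm (b - y))\<bar> \<le> \<phi> (norm (a - y)) + \<phi> (norm (b - y))"
proof -
  define m where "m = min (norm (a - y)) (norm (b - y))"
  have m: "0 < m" using y by (simp add: m_def)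
  have d: "\<bar>norm (a - y) - norm (b - y)\<bar> \<le> h"
    using norm_triangle_ineq3[of "a - y" "b - y"] by (simp add: h_def)
  have bound: "\<bar>ln (norm (a - y)) - ln (norm (b - y))\<bar> \<le> 1 / \<alpha> * (h / m) powr \<alpha>"
    if "0 < \<alpha>" "\<alpha> \<le> 1" for \<alpha>
  proof -
    have "\<bar>ln (norm (a - y)) - ln (norm (b - y))\<bar>
        \<le> 1 / \<alpha> * (\<bar>norm (a - y) - norm (b - y)\<bar> / m) powr \<alpha>"
      unfolding m_def using y that by (intro abs_ln_diff_le) auto
    also have "\<dots> \<le> 1 / \<alpha> * (h / m) powr \<alpha>"
      using d m that by (intro mult_left_mono powr_mono2 divide_right_mono) auto
    finally show ?thesis .
  qed
  \<comment> \<open>Near the singularity the exponent \<open>1 / s\<close> keeps the weight in L^s;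
    away from it the exponent 1 gives the decay \<open>h / m\<close>.\<close>
  have "\<bar>ln (norm (a - y)) - ln (norm (b - y))\<bar> \<le> \<phi> m"
  proof (cases "m < h")
    case True
    with bound[of "1 / s"] s show ?thesis by (simp add: \<phi>_def)
  next
    case False
    with bound[of 1] m show ?thesis by (simp add: \<phi>_def h_def)
  qed
  moreover have "0 \<le> \<phi> r" if "0 \<le> r" for r
    using that s by (simp add: \<phi>_def h_def)
  then have "0 \<le> \<phi> (norm (a - y))" "0 \<le> \<phi> (norm (b - y))"
    by simp_all
  moreover have "m = norm (a - y) \<or> m = norm (b - y)"
    by (simp add: m_def min_def)
  ultimately show ?thesis
    by auto
qed

text \<open>A bound for the single weight that is uniform in the centre is used at
  \<open>c = a\<close> and at \<open>c = b\<close>, whence the factor 2.\<close>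

lemma nn_integral_log_kernel_le:
  fixes f :: "real ^ 'n \<Rightarrow> real" and a b :: "real ^ 'n"
  assumes [measurable]: "f \<in> borel_measurable lebesgue" and s: "1 \<le> s" and "0 \<le> B"
  defines "h \<equiv> norm (a - b)"
  defines "\<phi> \<equiv> \<lambda>r. if r < h then s * (h / r) powr (1 / s) else h / r"
  assumes B: "\<And>c. (\<integral>\<^sup>+y. ennreal \<bar>\<phi> (norm (c - y)) * f y\<bar> \<partial>lebesgue) \<le> ennreal B"
  shows "(\<integral>\<^sup>+y. ennreal \<bar>(ln (norm (a - y)) - ln (norm (b - y))) * f y\<bar> \<partial>lebesgue) \<le> ennreal (2 * B)"
proof -
  have [measurable]: "\<phi> \<in> borel_measurable borel"
    unfolding \<phi>_def by measurable
  have [measurable]: "(\<lambda>y. \<phi> (norm (c - y))) \<in> borel_measurable lebesgue" for c :: "real ^ 'n"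
    by (rule measurable_completion) simp
  \<comment> \<open>The pointwise kernel bound excludes the two singular points, which form a null
    set.\<close>
  have "AE y in lebesgue. y \<noteq> a" "AE y in lebesgue. y \<noteq> b"
    using AE_lborel_singleton[of a] AE_lborel_singleton[of b] by (auto intro: AE_completion)
  then have "(\<integral>\<^sup>+y. ennreal \<bar>(ln (norm (a - y)) - ln (norm (b - y))) * f y\<bar> \<partial>lebesgue)
      \<le> (\<integral>\<^sup>+y. ennreal \<bar>\<phi> (norm (a - y)) * f y\<bar> + ennreal \<bar>\<phi> (norm (b - y)) * f y\<bar> \<partial>lebesgue)"
  proof (intro nn_integral_mono_AE, eventually_elim)
    fix y assume "y \<noteq> a" "y \<noteq> b"
    then have "\<bar>ln (norm (a - y)) - ln (norm (b - y))\<bar> \<le> \<phi> (norm (a - y)) + \<phi> (norm (b - y))"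
      unfolding \<phi>_def h_def using s by (intro log_kernel_le)
    then have "\<bar>ln (norm (a - y)) - ln (norm (b - y))\<bar> * \<bar>f y\<bar>
        \<le> (\<bar>\<phi> (norm (a - y))\<bar> + \<bar>\<phi> (norm (b - y))\<bar>) * \<bar>f y\<bar>"
      by (intro mult_right_mono) auto
    then show "ennreal \<bar>(ln (norm (a - y)) - ln (norm (b - y))) * f y\<bar>
        \<le> ennreal \<bar>\<phi> (norm (a - y)) * f y\<bar> + ennreal \<bar>\<phi> (norm (b - y)) * f y\<bar>"
      by (simp add: abs_mult distrib_right ennreal_leI flip: ennreal_plus)
  qed
  also have "\<dots> = (\<integral>\<^sup>+y. ennreal \<bar>\<phi> (norm (a - y)) * f y\<bar> \<partial>lebesgue) + (\<integral>\<^sup>+y. ennreal \<bar>\<phi> (norm (b - y)) * f y\<bar> \<partial>lebesgue)"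
    by (intro nn_integral_add) auto
  also have "\<dots> \<le> ennreal B + ennreal B"
    by (intro add_mono B)
  finally show ?thesis
    using \<open>0 \<le> B\<close> by (simp flip: ennreal_plus)
qed

text \<open>The kernel bound is assumed for all pairs of points because it serves twice: the pairs
  \<open>0, x\<close> and \<open>0, z\<close> give integrability of the two potentials, without
  which the difference of Bochner integrals could not be merged, and the pair \<open>x, z\<close>
  gives the estimate itself.\<close>

lemma modified_log_potential_diff_le:
  fixes f :: "real ^ 'n \<Rightarrow> real" and F :: "real \<Rightarrow> real"
  assumes [measurable]: "f \<in> borel_measurable lebesgue"
    and F: "\<And>a b. a \<noteq> b \<Longrightarrow>
      (\<integral>\<^sup>+y. ennreal \<bar>(ln (norm (a - y)) - ln (norm (b - y))) * f y\<bar> \<partial>lebesgue) \<le> ennreal (F (norm (a - b)))"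
    and xz: "x \<noteq> z" and F0: "0 \<le> F (norm (x - z))"
  shows "\<bar>modified_log_potential f x - modified_log_potential f z\<bar>
    \<le> Gamma (real CARD('n) / 2) / (2 * pi powr (real CARD('n) / 2)) * F (norm (x - z))"
proof -
  define L where "L a b y = (ln (norm (a - y)) - ln (norm (b - y))) * f y" for a b y
  have [measurable]: "(\<lambda>y. ln (norm (a - y))) \<in> borel_measurable lebesgue" for a :: "real ^ 'n"
    by (rule measurable_completion) simp
  \<comment> \<open>Equal points are treated separately, since \<open>x\<close> or \<open>z\<close>
    may be the origin and the kernel bound covers distinct points only.\<close>
  have L: "integrable lebesgue (L a b)" for a b
  proof (cases "a = b")
    case False
    have "(\<integral>\<^sup>+y. ennreal (norm (L a b y)) \<partial>lebesgue) \<le> ennreal (F (norm (a - b)))"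
      using F[OF False] by (simp add: L_def)
    also have "\<dots> < \<infinity>"
      by simp
    finally have "(\<integral>\<^sup>+y. ennreal (norm (L a b y)) \<partial>lebesgue) < \<infinity>" .
    moreover have "L a b \<in> borel_measurable lebesgue"
      unfolding L_def by measurable
    ultimately show ?thesis
      by (intro integrableI_bounded)
  next
    case True
    then have "L a b = (\<lambda>_. 0)"
      by (simp add: L_def fun_eq_iff)
    then show ?thesis by simp
  qed
  \<comment> \<open>At \<open>v = 0\<close> both sides are 0 by the conventions
    \<open>1 / 0 = 0\<close> and \<open>ln 0 = 0\<close>.\<close>
  have ln_inv: "ln (1 / norm v) = - ln (norm v)" for v :: "real ^ 'n"
    by (cases "v = 0") (simp_all add: ln_div)
  have eq: "(LINT y|lebesgue. (ln (1 / norm (w - y)) - ln (1 / norm y)) * f y) = (LINT y|lebesgue. L 0 w y)" for w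
    by (intro Bochner_Integration.integral_cong) (auto simp: L_def ln_inv)
  have "(LINT y|lebesgue. L 0 x y) - (LINT y|lebesgue. L 0 z y) = (LINT y|lebesgue. L 0 x y - L 0 z y)"
    using L by simp
  \<comment> \<open>The reference term \<open>ln (norm y)\<close> cancels in the difference.\<close>
  also have "\<dots> = - (LINT y|lebesgue. L x z y)"
    by (subst Bochner_Integration.integral_minus[symmetric], intro Bochner_Integration.integral_cong)
      (auto simp: L_def algebra_simps)
  finally have "\<bar>(LINT y|lebesgue. L 0 x y) - (LINT y|lebesgue. L 0 z y)\<bar> \<le> (LINT y|lebesgue. norm (L x z y))"
    using integral_norm_bound[of lebesgue "L x z"] by simp
  also have "\<dots> \<le> F (norm (x - z))"
  proof -
    have "ennreal (LINT y|lebesgue. norm (L x z y)) = (\<integral>\<^sup>+y. ennreal (norm (L x z y)) \<partial>lebesgue)"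
      using L by (intro nn_integral_eq_integral[symmetric]) auto
    also have "\<dots> \<le> ennreal (F (norm (x - z)))"
      using F[OF xz] by (simp add: L_def)
    finally show ?thesis
      using F0 by (simp add: ennreal_le_iff)
  qed
  finally have "\<bar>(LINT y|lebesgue. L 0 x y) - (LINT y|lebesgue. L 0 z y)\<bar> \<le> F (norm (x - z))" .
  moreover have "0 \<le> Gamma (real CARD('n) / 2) / (2 * pi powr (real CARD('n) / 2))"
    by (auto intro!: divide_nonneg_nonneg Gamma_real_nonneg)
  ultimately show ?thesis
    unfolding modified_log_potential_def eq right_diff_distrib[symmetric] abs_mult
    by (simp only: abs_of_nonneg mult_left_mono)
qed

section \<open>Exponents below the critical one: Hoelder continuity\<close>

text \<open>The strict bound on \<open>p\<close> says exactly that the conjugate exponent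
  \<open>s\<close> exceeds the dimension, so the weight lies in L^s both near its centre and at
  infinity. Splitting at radius \<open>h\<close>, each part contributes the power
  \<open>n / s = n - n / p\<close> of \<open>h\<close>.\<close>

lemma modified_log_potential_Hoelder:
  assumes N: "2 \<le> CARD('n::finite)" and p: "1 < p" "p < real CARD('n) / (real CARD('n) - 1)"
  shows "\<exists>C. \<forall>f :: real ^ 'n \<Rightarrow> real. f \<in> Lp_space p \<longrightarrow>
    (\<forall>x z. \<bar>modified_log_potential f x - modified_log_potential f z\<bar>
      \<le> C * norm (x - z) powr (real CARD('n) - real CARD('n) / p) * Lp_norm p f)"
proof -
  let ?n = "real CARD('n)"
  let ?G = "Gamma (?n / 2) / (2 * pi powr (?n / 2))"
  define s where "s = p / (p - 1)"
  have s: "1 < s" "1 / s + 1 / p = 1" "?n < s"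
    using p N by (auto simp: s_def field_simps)
  have e: "?n / s = ?n - ?n / p"
    using p by (simp add: s_def field_simps)
  obtain K1 where K1: "0 \<le> K1" and near: "\<And>(f :: real ^ 'n \<Rightarrow> real) c h. f \<in> Lp_space p \<Longrightarrow> 0 < h \<Longrightarrow>
       (\<integral>\<^sup>+y. ennreal \<bar>(if norm (c - y) < h then s * (h / norm (c - y)) powr (1 / s) else 0) * f y\<bar> \<partial>lebesgue)
         \<le> ennreal (K1 * h powr (?n / s) * Lp_norm p f)"
    using near_weight_bound[OF N s(1) p(1) s(2)] by blast
  obtain K2 where K2: "0 \<le> K2" and far: "\<And>(f :: real ^ 'n \<Rightarrow> real) c h R. f \<in> Lp_space p \<Longrightarrow> 0 < h \<Longrightarrow> 0 < R \<Longrightarrow>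
       (\<integral>\<^sup>+y. ennreal \<bar>(if R \<le> norm (c - y) then h / norm (c - y) else 0) * f y\<bar> \<partial>lebesgue)
         \<le> ennreal (K2 * h * R powr (?n / s - 1) * Lp_norm p f)"
    using far_weight_bound[OF p(1) s(2) N s(3)] by blast
  show ?thesis
  proof (rule exI[of _ "?G * (2 * (K1 + K2))"], intro allI impI)
    fix f :: "real ^ 'n \<Rightarrow> real" and x z
    assume f: "f \<in> Lp_space p"
    define F where "F h = 2 * ((K1 + K2) * h powr (?n / s) * Lp_norm p f)" for h
    have f': "f \<in> borel_measurable lebesgue"
      using f by (simp add: Lp_space_def)
    have kernel: "(\<integral>\<^sup>+y. ennreal \<bar>(ln (norm (a - y)) - ln (norm (b - y))) * f y\<bar> \<partial>lebesgue) \<le> ennreal (F (norm (a - b)))"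
      if "a \<noteq> b" for a b
      unfolding F_def
    proof (rule nn_integral_log_kernel_le[OF f'])
      fix c :: "real ^ 'n"
      define h where "h = norm (a - b)"
      have h: "0 < h" using that by (simp add: h_def)
      let ?w1 = "\<lambda>y. (if norm (c - y) < h then s * (h / norm (c - y)) powr (1 / s) else 0) * f y"
      let ?w2 = "\<lambda>y. (if h \<le> norm (c - y) then h / norm (c - y) else 0) * f y"
      have [measurable]: "?w1 \<in> borel_measurable lebesgue" "?w2 \<in> borel_measurable lebesgue"
        by (auto intro!: borel_measurable_times[OF measurable_completion f'])
      have "(\<integral>\<^sup>+y. ennreal \<bar>(if norm (c - y) < h then s * (h / norm (c - y)) powr (1 / s) else h / norm (c - y)) * f y\<bar> \<partial>lebesgue)
          = (\<integral>\<^sup>+y. ennreal \<bar>?w1 y\<bar> + ennreal \<bar>?w2 y\<bar> \<partial>lebesgue)"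
        by (intro nn_integral_cong) auto
      also have "\<dots> = (\<integral>\<^sup>+y. ennreal \<bar>?w1 y\<bar> \<partial>lebesgue) + (\<integral>\<^sup>+y. ennreal \<bar>?w2 y\<bar> \<partial>lebesgue)"
        by (intro nn_integral_add) auto
      \<comment> \<open>The far estimate is taken with \<open>R = h\<close>, so that
        \<open>h * h powr (n / s - 1)\<close> matches the near power.\<close>
      also have "\<dots> \<le> ennreal (K1 * h powr (?n / s) * Lp_norm p f) + ennreal (K2 * h * h powr (?n / s - 1) * Lp_norm p f)"
        by (intro add_mono near far f h)
      also have "\<dots> = ennreal ((K1 + K2) * h powr (?n / s) * Lp_norm p f)"
        using K1 K2 h Lp_norm_nonneg[of p f]
        by (simp add: powr_diff algebra_simps flip: ennreal_plus)
      finally show "(\<integral>\<^sup>+y. ennreal \<bar>(if norm (c - y) < norm (a - b) then s * (norm (a - b) / norm (c - y)) powr (1 / s)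
           else norm (a - b) / norm (c - y)) * f y\<bar> \<partial>lebesgue)
         \<le> ennreal ((K1 + K2) * norm (a - b) powr (?n / s) * Lp_norm p f)"
        unfolding h_def .
    qed (use K1 K2 s Lp_norm_nonneg[of p f] in auto)
    show "\<bar>modified_log_potential f x - modified_log_potential f z\<bar>
      \<le> ?G * (2 * (K1 + K2)) * norm (x - z) powr (?n - ?n / p) * Lp_norm p f"
    \<comment> \<open>For \<open>x = z\<close> both sides vanish because
      \<open>0 powr a = 0\<close>.\<close>
    proof (cases "x = z")
      case False
      have "0 \<le> F (norm (x - z))"
        using K1 K2 Lp_norm_nonneg[of p f] by (simp add: F_def)
      then have "\<bar>modified_log_potential f x - modified_log_potential f z\<bar> \<le> ?G * F (norm (x - z))"
        by (intro modified_log_potential_diff_le[where F = F] f' kernel False)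
      then show ?thesis by (simp only: F_def e mult.assoc)
    qed simp
  qed
qed

section \<open>The critical exponent: Lipschitz continuity up to a logarithm\<close>

text \<open>For \<open>q = 1\<close> there is no finite conjugate exponent, but beyond radius 1 the
  weight is bounded by \<open>h\<close>. For q > 1 the conjugate exponent exceeds the dimension, and
  the factor \<open>R powr (n / s - 1)\<close> is at most 1 because its exponent is negative and R
  \<ge> 1.\<close>

lemma far_weight_bound_subcritical:
  assumes N: "2 \<le> CARD('n::finite)" and q: "1 \<le> q" "q < real CARD('n) / (real CARD('n) - 1)"
  obtains K where "0 \<le> K"
    "\<And>(f :: real ^ 'n \<Rightarrow> real) c h R. f \<in> Lp_space q \<Longrightarrow> 0 < h \<Longrightarrow> 1 \<le> R \<Longrightarrow>
       (\<integral>\<^sup>+y. ennreal \<bar>(if R \<le> norm (c - y) then h / norm (c - y) else 0) * f y\<bar> \<partial>lebesgue)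
         \<le> ennreal (K * h * Lp_norm q f)"
proof (cases "q = 1")
  case True
  have "(\<integral>\<^sup>+y. ennreal \<bar>(if R \<le> norm (c - y) then h / norm (c - y) else 0) * f y\<bar> \<partial>lebesgue)
      \<le> ennreal (1 * h * Lp_norm q f)"
    if f: "f \<in> Lp_space q" and h: "0 < h" and R: "1 \<le> R" for f :: "real ^ 'n \<Rightarrow> real" and c h R
  proof -
    have int: "integrable lebesgue (\<lambda>y. \<bar>f y\<bar>)"
      using f True by (simp add: Lp_space_def)
    have "h / r \<le> h" if "1 \<le> r" for r
      using divide_left_mono[of 1 r h] h that by simp
    then have w: "\<bar>if R \<le> norm (c - y) then h / norm (c - y) else 0\<bar> \<le> h" for y
      using h R by auto
    have "(\<integral>\<^sup>+y. ennreal \<bar>(if R \<le> norm (c - y) then h / norm (c - y) else 0) * f y\<bar> \<partial>lebesgue)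
        \<le> (\<integral>\<^sup>+y. ennreal (h * \<bar>f y\<bar>) \<partial>lebesgue)"
      unfolding abs_mult by (intro nn_integral_mono ennreal_leI mult_right_mono w) auto
    also have "\<dots> = ennreal (LINT y|lebesgue. h * \<bar>f y\<bar>)"
      using int h by (intro nn_integral_eq_integral) auto
    also have "(LINT y|lebesgue. h * \<bar>f y\<bar>) = h * Lp_norm q f"
      using True by (simp add: Lp_norm_def)
    finally show ?thesis by simp
  qed
  then show thesis by (intro that[of 1]) auto
next
  case False
  define s where "s = q / (q - 1)"
  have s: "1 < q" "1 / s + 1 / q = 1" "real CARD('n) < s"
    using q N False by (auto simp: s_def field_simps)
  obtain K where K: "0 \<le> K" and far: "\<And>(f :: real ^ 'n \<Rightarrow> real) c h R. f \<in> Lp_space q \<Longrightarrow> 0 < h \<Longrightarrow> 0 < R \<Longrightarrow>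
       (\<integral>\<^sup>+y. ennreal \<bar>(if R \<le> norm (c - y) then h / norm (c - y) else 0) * f y\<bar> \<partial>lebesgue)
         \<le> ennreal (K * h * R powr (real CARD('n) / s - 1) * Lp_norm q f)"
    using far_weight_bound[OF s(1,2) N s(3)] by blast
  have "(\<integral>\<^sup>+y. ennreal \<bar>(if R \<le> norm (c - y) then h / norm (c - y) else 0) * f y\<bar> \<partial>lebesgue)
         \<le> ennreal (K * h * Lp_norm q f)"
    if f: "f \<in> Lp_space q" and h: "0 < h" and R: "1 \<le> R" for f :: "real ^ 'n \<Rightarrow> real" and c h R
  proof -
    have "R powr (real CARD('n) / s - 1) \<le> R powr 0"
      using R s N by (intro powr_mono) (auto simp: field_simps)
    then have "K * h * R powr (real CARD('n) / s - 1) * Lp_norm q f \<le> K * h * 1 * Lp_norm q f"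
      using K h R Lp_norm_nonneg[of q f] by (intro mult_right_mono mult_left_mono) auto
    then show ?thesis
      using far[OF f h, of R c] R by (auto intro: order_trans ennreal_leI)
  qed
  with K show thesis by (rule that)
qed

text \<open>Converts the logarithm of the annulus from \<open>h\<close> to \<open>h + 1\<close> into
  the factor of the final estimate. For small \<open>h\<close> the term \<open>- ln h\<close>
  dominates; for h > 1 the left side is at most \<open>1 / h\<close>.\<close>

lemma ln_one_plus_inverse_le:
  fixes h :: real
  assumes "0 < h"
  shows "ln ((h + 1) / h) \<le> \<bar>ln h\<bar> + 1"
proof (cases "h \<le> 1")
  case True
  have "ln ((h + 1) / h) = ln (1 + h) - ln h"
    using assms by (simp add: ln_div add.commute)
  then show ?thesis
    using ln_add_one_self_le_self[of h] assms True by simp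
next
  case False
  have "ln ((h + 1) / h) = ln (1 + 1 / h)"
    using assms by (simp add: add_divide_distrib)
  also have "\<dots> \<le> 1 / h"
    using assms by (intro ln_add_one_self_le_self) auto
  also have "\<dots> \<le> 1" using False by simp
  finally show ?thesis by simp
qed

text \<open>Here the conjugate exponent of \<open>p\<close> equals the dimension, so the near part
  is linear in \<open>h\<close>, but the tail of the weight is no longer in L^n. The weight is
  therefore cut at \<open>h\<close> and \<open>h + 1\<close>: the L^p norm controls the ball and the
  annulus, the L^q norm the rest.\<close>

lemma modified_log_potential_log_Lipschitz:
  assumes N: "2 \<le> CARD('n::finite)" and p: "p = real CARD('n) / (real CARD('n) - 1)"
    and q: "1 \<le> q" "q < p"
  shows "\<exists>C. \<forall>f :: real ^ 'n \<Rightarrow> real. f \<in> Lp_space p \<inter> Lp_space q \<longrightarrow>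
    (\<forall>x z. \<bar>modified_log_potential f x - modified_log_potential f z\<bar>
      \<le> C * norm (x - z) * (\<bar>ln (norm (x - z))\<bar> + 1) powr (1 / real CARD('n)) * (Lp_norm p f + Lp_norm q f))"
proof -
  let ?n = "real CARD('n)"
  let ?G = "Gamma (?n / 2) / (2 * pi powr (?n / 2))"
  have n: "1 < p" "1 < ?n" "1 / ?n + 1 / p = 1"
    unfolding p using N by (auto simp: field_simps)
  have q': "q < ?n / (?n - 1)" using p q by simp
  obtain K1 where K1: "0 \<le> K1" and near: "\<And>(f :: real ^ 'n \<Rightarrow> real) c h. f \<in> Lp_space p \<Longrightarrow> 0 < h \<Longrightarrow>
       (\<integral>\<^sup>+y. ennreal \<bar>(if norm (c - y) < h then ?n * (h / norm (c - y)) powr (1 / ?n) else 0) * f y\<bar> \<partial>lebesgue)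
         \<le> ennreal (K1 * h powr (?n / ?n) * Lp_norm p f)"
    using near_weight_bound[OF N n(2,1,3)] by blast
  obtain K2 where K2: "0 \<le> K2" and mid: "\<And>(f :: real ^ 'n \<Rightarrow> real) c h R. f \<in> Lp_space p \<Longrightarrow> 0 < h \<Longrightarrow> h \<le> R \<Longrightarrow>
       (\<integral>\<^sup>+y. ennreal \<bar>(if h \<le> norm (c - y) \<and> norm (c - y) < R then h / norm (c - y) else 0) * f y\<bar> \<partial>lebesgue)
         \<le> ennreal (K2 * h * ln (R / h) powr (1 / ?n) * Lp_norm p f)"
    using annulus_weight_bound[OF n(1,3) N] by blast
  obtain K3 where K3: "0 \<le> K3" and far: "\<And>(f :: real ^ 'n \<Rightarrow> real) c h R. f \<in> Lp_space q \<Longrightarrow> 0 < h \<Longrightarrow> 1 \<le> R \<Longrightarrow>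
       (\<integral>\<^sup>+y. ennreal \<bar>(if R \<le> norm (c - y) then h / norm (c - y) else 0) * f y\<bar> \<partial>lebesgue)
         \<le> ennreal (K3 * h * Lp_norm q f)"
    using far_weight_bound_subcritical[OF N q(1) q'] by blast
  show ?thesis
  proof (rule exI[of _ "?G * (2 * (K1 + K2 + K3))"], intro allI impI)
    fix f :: "real ^ 'n \<Rightarrow> real" and x z
    assume "f \<in> Lp_space p \<inter> Lp_space q"
    then have fp: "f \<in> Lp_space p" and fq: "f \<in> Lp_space q" by auto
    define P Q where "P = Lp_norm p f" and "Q = Lp_norm q f"
    have PQ: "0 \<le> P" "0 \<le> Q"
      by (simp_all add: P_def Q_def Lp_norm_nonneg)
    define \<Lambda> where "\<Lambda> h = (\<bar>ln h\<bar> + 1) powr (1 / ?n)" for h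
    define F where "F h = 2 * ((K1 + K2 + K3) * h * \<Lambda> h * (P + Q))" for h
    have f': "f \<in> borel_measurable lebesgue"
      using fp by (simp add: Lp_space_def)
    \<comment> \<open>Lets the near and far terms, which carry no logarithm, be absorbed into the
      logarithmic factor.\<close>
    have \<Lambda>: "1 \<le> \<Lambda> h" for h
      unfolding \<Lambda>_def by (rule ge_one_powr_ge_zero) auto
    have kernel: "(\<integral>\<^sup>+y. ennreal \<bar>(ln (norm (a - y)) - ln (norm (b - y))) * f y\<bar> \<partial>lebesgue) \<le> ennreal (F (norm (a - b)))"
      if "a \<noteq> b" for a b
      unfolding F_def
    proof (rule nn_integral_log_kernel_le[OF f'])
      fix c :: "real ^ 'n"
      define h where "h = norm (a - b)"
      have h: "0 < h" using that by (simp add: h_def)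
      let ?w1 = "\<lambda>y. (if norm (c - y) < h then ?n * (h / norm (c - y)) powr (1 / ?n) else 0) * f y"
      \<comment> \<open>The outer radius \<open>h + 1\<close> is at least 1, as the L^q estimate
        requires, and keeps the logarithm of the ratio of the radii bounded for large
        \<open>h\<close>.\<close>
      let ?w2 = "\<lambda>y. (if h \<le> norm (c - y) \<and> norm (c - y) < h + 1 then h / norm (c - y) else 0) * f y"
      let ?w3 = "\<lambda>y. (if h + 1 \<le> norm (c - y) then h / norm (c - y) else 0) * f y"
      have [measurable]: "?w1 \<in> borel_measurable lebesgue" "?w2 \<in> borel_measurable lebesgue"
          "?w3 \<in> borel_measurable lebesgue"
        by (auto intro!: borel_measurable_times[OF measurable_completion f'])
      have "(\<integral>\<^sup>+y. ennreal \<bar>(if norm (c - y) < h then ?n * (h / norm (c - y)) powr (1 / ?n) else h / norm (c - y)) * f y\<bar> \<partial>lebesgue)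
          = (\<integral>\<^sup>+y. ennreal \<bar>?w1 y\<bar> + (ennreal \<bar>?w2 y\<bar> + ennreal \<bar>?w3 y\<bar>) \<partial>lebesgue)"
        by (intro nn_integral_cong) auto
      also have "\<dots> = (\<integral>\<^sup>+y. ennreal \<bar>?w1 y\<bar> \<partial>lebesgue) + (\<integral>\<^sup>+y. ennreal \<bar>?w2 y\<bar> + ennreal \<bar>?w3 y\<bar> \<partial>lebesgue)"
        by (intro nn_integral_add) auto
      also have "(\<integral>\<^sup>+y. ennreal \<bar>?w2 y\<bar> + ennreal \<bar>?w3 y\<bar> \<partial>lebesgue)
          = (\<integral>\<^sup>+y. ennreal \<bar>?w2 y\<bar> \<partial>lebesgue) + (\<integral>\<^sup>+y. ennreal \<bar>?w3 y\<bar> \<partial>lebesgue)"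
        by (intro nn_integral_add) auto
      also have "(\<integral>\<^sup>+y. ennreal \<bar>?w1 y\<bar> \<partial>lebesgue) + \<dots>
          \<le> ennreal (K1 * h powr (?n / ?n) * P) + (ennreal (K2 * h * ln ((h + 1) / h) powr (1 / ?n) * P) + ennreal (K3 * h * Q))"
        unfolding P_def Q_def using h by (intro add_mono near mid far fp fq) auto
      also have "\<dots> = ennreal (K1 * h * P + (K2 * h * ln ((h + 1) / h) powr (1 / ?n) * P + K3 * h * Q))"
        using K1 K2 K3 h PQ by (simp flip: ennreal_plus)
      also have "\<dots> \<le> ennreal ((K1 + K2 + K3) * h * \<Lambda> h * (P + Q))"
      proof (rule ennreal_leI)
        have "ln ((h + 1) / h) powr (1 / ?n) \<le> \<Lambda> h"
          unfolding \<Lambda>_def using h by (intro powr_mono2 ln_one_plus_inverse_le) auto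
        \<comment> \<open>Each of the three terms is enlarged to the common factor \<Lambda>(h) (P +
          Q).\<close>
        then have "K1 * h * P + (K2 * h * ln ((h + 1) / h) powr (1 / ?n) * P + K3 * h * Q)
            \<le> K1 * h * (\<Lambda> h * (P + Q)) + (K2 * h * (\<Lambda> h * (P + Q)) + K3 * h * (\<Lambda> h * (P + Q)))"
          unfolding mult.assoc using K1 K2 K3 h PQ \<Lambda>[of h] mult_mono[of 1 "\<Lambda> h" P "P + Q"] mult_mono[of 1 "\<Lambda> h" Q "P + Q"]
          by (intro add_mono mult_left_mono mult_mono) auto
        also have "\<dots> = (K1 + K2 + K3) * h * \<Lambda> h * (P + Q)"
          by (simp add: algebra_simps)
        finally show "K1 * h * P + (K2 * h * ln ((h + 1) / h) powr (1 / ?n) * P + K3 * h * Q)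
            \<le> (K1 + K2 + K3) * h * \<Lambda> h * (P + Q)" .
      qed
      finally show "(\<integral>\<^sup>+y. ennreal \<bar>(if norm (c - y) < norm (a - b) then ?n * (norm (a - b) / norm (c - y)) powr (1 / ?n)
           else norm (a - b) / norm (c - y)) * f y\<bar> \<partial>lebesgue)
         \<le> ennreal ((K1 + K2 + K3) * norm (a - b) * \<Lambda> (norm (a - b)) * (P + Q))"
        unfolding h_def .
    next
      show "0 \<le> (K1 + K2 + K3) * norm (a - b) * \<Lambda> (norm (a - b)) * (P + Q)"
        using K1 K2 K3 PQ by (simp add: \<Lambda>_def)
    qed (use n in auto)
    show "\<bar>modified_log_potential f x - modified_log_potential f z\<bar>
      \<le> ?G * (2 * (K1 + K2 + K3)) * norm (x - z) * (\<bar>ln (norm (x - z))\<bar> + 1) powr (1 / ?n) * (Lp_norm p f + Lp_norm q f)"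
    proof (cases "x = z")
      case False
      have "0 \<le> F (norm (x - z))"
        using K1 K2 K3 PQ by (simp add: F_def \<Lambda>_def)
      then have "\<bar>modified_log_potential f x - modified_log_potential f z\<bar> \<le> ?G * F (norm (x - z))"
        by (intro modified_log_potential_diff_le[where F = F] f' kernel False)
      then show ?thesis by (simp only: F_def \<Lambda>_def P_def Q_def mult.assoc)
    qed simp
  qed
qed

theorem theoremB:
  fixes N :: nat and p :: real
  assumes "N = CARD('n::finite)" and "N \<ge> 2"
    and "1 < p" and "p \<le> real N / (real N - 1)"
  shows
    "(p < real N / (real N - 1) \<longrightarrow>
       (\<exists>C::real. \<forall>f :: real ^ 'n \<Rightarrow> real. f \<in> Lp_space p \<longrightarrow>
         (\<forall>x z. \<bar>modified_log_potential f x - modified_log_potential f z\<bar>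
            \<le> C * norm (x - z) powr (real N - real N / p) * Lp_norm p f))) \<and>
     (p = real N / (real N - 1) \<longrightarrow>
       (\<forall>q::real. 1 \<le> q \<and> q < p \<longrightarrow>
         (\<exists>C::real. \<forall>f :: real ^ 'n \<Rightarrow> real. f \<in> Lp_space p \<inter> Lp_space q \<longrightarrow>
           (\<forall>x z. \<bar>modified_log_potential f x - modified_log_potential f z\<bar>
              \<le> C * norm (x - z) * (\<bar>ln (norm (x - z))\<bar> + 1) powr (1 / real N)
                 * (Lp_norm p f + Lp_norm q f)))))"
  using modified_log_potential_Hoelder[where 'n = 'n, of p]
    modified_log_potential_log_Lipschitz[where 'n = 'n, of p] assms
  by blast

end
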